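(* Let $m\in\mathbb{N}$ be a positive integer and let $G = A_4\times\mathbb{Z}/m\mathbb{Z}$, where $A_4$ is the alternating group on four letters. Up to automorphisms of $F_2$ there exists only one origami-curve of normal origamis with Galois group $G$. That is, the set $$\mathrm{Aut}(G)\backslash\mathrm{Epi}(F_2,G)/\mathrm{Aut}(F_2)$$ has exactly one element: surjective homomorphisms $F_2\to G$ exist, and for any two of them $f,f':F_2\to G$ there are $\varphi\in\mathrm{Aut}(F_2)$ and $\psi\in\mathrm{Aut}(G)$ with $f'=\psi\circ f\circ\varphi$.
   Context: $F_2$ is the free group on two generators $x,y$, and $\mathrm{Epi}(F_2,G)$ is the set of surjective homomorphisms $F_2\to G$, on which $\mathrm{Aut}(G)$ acts by post-composition and $\mathrm{Aut}(F_2)$ by pre-composition (inner automorphisms of $F_2$ act trivially modulo $\mathrm{Aut}(G)$, so one may equally write $\mathrm{Out}(F_2)$). A (complex) origami is a covering $p:X\to E$ of a connected surface $X$ over the torus $E=\mathbb{R}^2/\mathbb{Z}^2$ ramified at most over $0\in E$. It is normal with Galois group $G$ if $G$ acts on $X$ with $E=X/G$; its monodromy is then a surjective homomorphism $f:F_2=\pi_1(E\setminus\{0\})\to G$, well-defined up to $\mathrm{Aut}(G)$, where $x,y$ are the horizontal and vertical closed paths. Varying the complex structure of the torus by $A\in\mathrm{SL}_2(\mathbb{R})$ gives Riemann surfaces $X_A$, which form an algebraic curve in the moduli space of Riemann surfaces, the origami-curve of the origami. The origami-curves of normal origamis with Galois group $G$ are identified with the elements of $\mathrm{Aut}(G)\backslash\mathrm{Epi}(F_2,G)/\mathrm{Out}(F_2)$.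 *)

theory Defs
  imports "HOL-Algebra.Algebra"
begin

section \<open>Free groups\<close>

text \<open>
  The free group on a set \<open>S\<close> is the group of reduced words over the letters \<open>s\<close> and \<open>s\<close> inverse
  with \<open>s\<close> in \<open>S\<close>, written \<open>(s, True)\<close> and \<open>(s, False)\<close>; the product is the reduced form of the
  concatenation.
\<close>

type_synonym 'a word = "('a \<times> bool) list"

definition inv_letter :: "'a \<times> bool \<Rightarrow> 'a \<times> bool" where
  "inv_letter a = (fst a, \<not> snd a)"

fun reduced :: "'a word \<Rightarrow> bool" where
  "reduced [] \<longleftrightarrow> True"
| "reduced [a] \<longleftrightarrow> True"
| "reduced (a # b # w) \<longleftrightarrow> b \<noteq> inv_letter a \<and> reduced (b # w)"

fun cancel_Cons :: "'a \<times> bool \<Rightarrow> 'a word \<Rightarrow> 'a word" where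
  "cancel_Cons a [] = [a]"
| "cancel_Cons a (b # w) = (if b = inv_letter a then w else a # b # w)"

definition reduced_mult :: "'a word \<Rightarrow> 'a word \<Rightarrow> 'a word" where
  "reduced_mult u v = foldr cancel_Cons u v"

definition free_group :: "'a set \<Rightarrow> 'a word monoid" where
  "free_group S =
    \<lparr>carrier = {w. fst ` set w \<subseteq> S \<and> reduced w}, monoid.mult = reduced_mult, one = []\<rparr>"

definition free_gen :: "'a \<Rightarrow> 'a word" where
  "free_gen s = [(s, True)]"

subsection \<open>Group axioms and universal property\<close>

lemma inv_letter_inv_letter [simp]: "inv_letter (inv_letter a) = a"
  by (simp add: inv_letter_def)

lemma fst_inv_letter [simp]: "fst (inv_letter a) = fst a"
  by (simp add: inv_letter_def)

lemma reduced_ConsD: "reduced (a # w) \<Longrightarrow> reduced w"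
  by (cases w) auto

lemma reduced_cancel_Cons: "reduced w \<Longrightarrow> reduced (cancel_Cons a w)"
  by (cases w) (auto dest: reduced_ConsD)

lemma cancel_Cons_reduced: "reduced (a # w) \<Longrightarrow> cancel_Cons a w = a # w"
  by (cases w) auto

lemma cancel_Cons_inv: "reduced w \<Longrightarrow> cancel_Cons a (cancel_Cons (inv_letter a) w) = w"
  by (cases w) (auto simp: cancel_Cons_reduced)

lemma set_cancel_Cons: "set (cancel_Cons a w) \<subseteq> insert a (set w)"
  by (cases w) auto

lemma reduced_reduced_mult: "reduced v \<Longrightarrow> reduced (reduced_mult u v)"
  unfolding reduced_mult_def by (induction u) (auto intro: reduced_cancel_Cons)

lemma set_reduced_mult: "set (reduced_mult u v) \<subseteq> set u \<union> set v"
proof (induction u)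
  case (Cons a u)
  then show ?case
    using set_cancel_Cons[of a "reduced_mult u v"] by (auto simp: reduced_mult_def)
qed (simp add: reduced_mult_def)

lemma reduced_mult_Nil_right: "reduced w \<Longrightarrow> reduced_mult w [] = w"
proof (induction w)
  case (Cons a w)
  then show ?case
    using cancel_Cons_reduced[of a w] reduced_ConsD[of a w] by (simp add: reduced_mult_def)
qed (simp add: reduced_mult_def)

lemma reduced_mult_cancel_Cons:
  assumes "reduced w"
  shows "reduced_mult (cancel_Cons a v) w = cancel_Cons a (reduced_mult v w)"
proof (cases v)
  case (Cons b v')
  show ?thesis
  proof (cases "b = inv_letter a")
    case True
    then show ?thesis
      using Cons cancel_Cons_inv[of "reduced_mult v' w" a] reduced_reduced_mult[OF assms, of v']
      by (simp add: reduced_mult_def)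
  qed (simp add: Cons reduced_mult_def)
qed (simp add: reduced_mult_def)

lemma reduced_mult_assoc:
  assumes "reduced w"
  shows "reduced_mult (reduced_mult u v) w = reduced_mult u (reduced_mult v w)"
proof (induction u)
  case (Cons a u)
  have "reduced_mult (a # u) v = cancel_Cons a (reduced_mult u v)" for v
    by (simp add: reduced_mult_def)
  then show ?case
    using Cons reduced_mult_cancel_Cons[OF assms] by simp
qed (simp add: reduced_mult_def)

lemma reduced_map_inv_letter: "reduced w \<Longrightarrow> reduced (map inv_letter w)"
  by (induction w rule: reduced.induct) (auto, metis inv_letter_inv_letter)

lemma reduced_snoc:
  "reduced (w @ [a]) \<longleftrightarrow> reduced w \<and> (w \<noteq> [] \<longrightarrow> a \<noteq> inv_letter (last w))"
  by (induction w rule: reduced.induct) auto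

lemma reduced_rev: "reduced w \<Longrightarrow> reduced (rev w)"
proof (induction w rule: reduced.induct)
  case (3 a b w)
  have "reduced (rev (b # w))" "a \<noteq> inv_letter b"
    using 3 by (simp, metis inv_letter_inv_letter reduced.simps(3))
  then have "reduced (rev (b # w) @ [a])"
    unfolding reduced_snoc by simp
  then show ?case
    by simp
qed simp_all

lemma reduced_mult_inv:
  "reduced w \<Longrightarrow> reduced_mult (rev (map inv_letter w)) w = []"
proof (induction w)
  case (Cons a w)
  have "reduced_mult (rev (map inv_letter (a # w))) (a # w)
      = reduced_mult (rev (map inv_letter w)) w"
    by (simp add: reduced_mult_def)
  then show ?case
    using Cons reduced_ConsD by metis
qed (simp add: reduced_mult_def)

lemma carrier_free_group: "w \<in> carrier (free_group S) \<longleftrightarrow> fst ` set w \<subseteq> S \<and> reduced w"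
  by (simp add: free_group_def)

lemma mult_free_group: "u \<otimes>\<^bsub>free_group S\<^esub> v = reduced_mult u v"
  by (simp add: free_group_def)

lemma one_free_group: "\<one>\<^bsub>free_group S\<^esub> = []"
  by (simp add: free_group_def)

theorem group_free_group: "group (free_group S)"
proof (rule groupI)
  fix x y
  assume *: "x \<in> carrier (free_group S)" "y \<in> carrier (free_group S)"
  have "fst ` set (reduced_mult x y) \<subseteq> fst ` (set x \<union> set y)"
    by (rule image_mono[OF set_reduced_mult])
  also have "\<dots> \<subseteq> S"
    using * by (simp add: carrier_free_group image_Un)
  finally show "x \<otimes>\<^bsub>free_group S\<^esub> y \<in> carrier (free_group S)"
    using * by (simp add: carrier_free_group mult_free_group reduced_reduced_mult)
next
  show "\<one>\<^bsub>free_group S\<^esub> \<in> carrier (free_group S)"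
    by (simp add: carrier_free_group one_free_group)
next
  fix x y z
  assume "z \<in> carrier (free_group S)"
  then show "x \<otimes>\<^bsub>free_group S\<^esub> y \<otimes>\<^bsub>free_group S\<^esub> z = x \<otimes>\<^bsub>free_group S\<^esub> (y \<otimes>\<^bsub>free_group S\<^esub> z)"
    by (simp add: carrier_free_group mult_free_group reduced_mult_assoc)
next
  fix x
  show "\<one>\<^bsub>free_group S\<^esub> \<otimes>\<^bsub>free_group S\<^esub> x = x"
    by (simp add: mult_free_group one_free_group reduced_mult_def)
next
  fix x
  assume *: "x \<in> carrier (free_group S)"
  show "\<exists>y\<in>carrier (free_group S). y \<otimes>\<^bsub>free_group S\<^esub> x = \<one>\<^bsub>free_group S\<^esub>"
  proof (rule bexI)
    show "rev (map inv_letter x) \<otimes>\<^bsub>free_group S\<^esub> x = \<one>\<^bsub>free_group S\<^esub>"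
      using * by (simp add: carrier_free_group mult_free_group one_free_group reduced_mult_inv)
    show "rev (map inv_letter x) \<in> carrier (free_group S)"
      using * by (simp add: carrier_free_group reduced_rev reduced_map_inv_letter image_image)
  qed
qed

lemma free_gen_in_carrier: "s \<in> S \<Longrightarrow> free_gen s \<in> carrier (free_group S)"
  by (simp add: free_group_def free_gen_def)

definition free_eval :: "('b, 'c) monoid_scheme \<Rightarrow> ('a \<Rightarrow> 'b) \<Rightarrow> 'a word \<Rightarrow> 'b" where
  "free_eval H g w =
    foldr (\<lambda>a h. (if snd a then g (fst a) else inv\<^bsub>H\<^esub> g (fst a)) \<otimes>\<^bsub>H\<^esub> h) w \<one>\<^bsub>H\<^esub>"

lemma free_eval_Nil: "free_eval H g [] = \<one>\<^bsub>H\<^esub>"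
  by (simp add: free_eval_def)

lemma free_eval_Cons:
  "free_eval H g (a # w) = (if snd a then g (fst a) else inv\<^bsub>H\<^esub> g (fst a)) \<otimes>\<^bsub>H\<^esub> free_eval H g w"
  by (simp add: free_eval_def)

context
  fixes H (structure) and S :: "'a set" and g :: "'a \<Rightarrow> 'b"
  assumes grp: "group H" and gS: "g \<in> S \<rightarrow> carrier H"
begin

interpretation group H by (rule grp)

lemma free_eval_closed: "fst ` set w \<subseteq> S \<Longrightarrow> free_eval H g w \<in> carrier H"
  using gS by (induction w) (auto simp: free_eval_Nil free_eval_Cons)

lemma free_eval_cancel_Cons:
  assumes "fst a \<in> S" "fst ` set w \<subseteq> S"
  shows "free_eval H g (cancel_Cons a w) = free_eval H g (a # w)"
proof (cases w)
  case (Cons b v)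
  have cl: "free_eval H g v \<in> carrier H" "g (fst a) \<in> carrier H"
    using assms Cons free_eval_closed gS by auto
  then show ?thesis
    using Cons
    by (auto simp: free_eval_Cons inv_letter_def m_assoc[symmetric] split: if_splits)
qed simp

lemma free_eval_reduced_mult:
  assumes "fst ` set u \<subseteq> S" "fst ` set v \<subseteq> S"
  shows "free_eval H g (reduced_mult u v) = free_eval H g u \<otimes> free_eval H g v"
  using assms
proof (induction u)
  case Nil
  then show ?case
    using free_eval_closed by (simp add: reduced_mult_def free_eval_Nil)
next
  case (Cons a u)
  have set: "fst ` set (reduced_mult u v) \<subseteq> S"
    using set_reduced_mult[of u v] Cons.prems by (auto dest!: subsetD)
  have cl: "free_eval H g u \<in> carrier H" "free_eval H g v \<in> carrier H" "g (fst a) \<in> carrier H"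
    using Cons.prems free_eval_closed gS by auto
  have "free_eval H g (reduced_mult (a # u) v) = free_eval H g (a # reduced_mult u v)"
    using free_eval_cancel_Cons[OF _ set, of a] Cons.prems by (simp add: reduced_mult_def)
  then show ?case
    using Cons cl by (auto simp: free_eval_Cons m_assoc)
qed

lemma free_eval_hom: "free_eval H g \<in> hom (free_group S) H"
  by (rule homI) (auto simp: free_group_def free_eval_closed free_eval_reduced_mult)

lemma free_eval_gen: "s \<in> S \<Longrightarrow> free_eval H g (free_gen s) = g s"
  using Pi_mem[OF gS] by (simp add: free_eval_def free_gen_def)

lemma free_eval_unique:
  assumes h: "h \<in> hom (free_group S) H" and hg: "\<And>s. s \<in> S \<Longrightarrow> h (free_gen s) = g s"
    and w: "w \<in> carrier (free_group S)"
  shows "h w = free_eval H g w"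
proof -
  interpret F: group "free_group S" by (rule group_free_group)
  interpret hm: group_hom "free_group S" H h
    using h by (simp add: group_hom_def group_hom_axioms_def F.is_group is_group)
  show ?thesis
    using w
  proof (induction w)
    case Nil
    then show ?case
      using hm.hom_one by (simp add: free_group_def free_eval_Nil)
  next
    case (Cons a w)
    have w: "w \<in> carrier (free_group S)" and s: "fst a \<in> S"
      using Cons.prems reduced_ConsD[of a w] by (auto simp: free_group_def)
    have a: "[a] \<in> carrier (free_group S)"
      using s by (simp add: free_group_def)
    have "a # w = [a] \<otimes>\<^bsub>free_group S\<^esub> w"
      using Cons.prems cancel_Cons_reduced[of a w] by (simp add: free_group_def reduced_mult_def)
    then have 1: "h (a # w) = h [a] \<otimes> h w"
      using hm.hom_mult[OF a w] by simp
    have 2: "h [a] = (if snd a then g (fst a) else inv g (fst a))"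
    proof (cases "snd a")
      case True
      then show ?thesis
        using hg[OF s] by (simp add: free_gen_def) (metis prod.collapse)
    next
      case False
      then have "[a] \<otimes>\<^bsub>free_group S\<^esub> free_gen (fst a) = \<one>\<^bsub>free_group S\<^esub>"
        by (simp add: free_group_def reduced_mult_def free_gen_def inv_letter_def)
      then have "[a] = inv\<^bsub>free_group S\<^esub> free_gen (fst a)"
        using F.inv_equality a free_gen_in_carrier[OF s] by metis
      then show ?thesis
        using False hm.hom_inv[OF free_gen_in_carrier[OF s]] hg[OF s] by simp
    qed
    show ?case
      using 1 2 Cons.IH[OF w] by (simp add: free_eval_Cons)
  qed
qed

end

datatype xy = X | Y

abbreviation F2 :: "xy word monoid" where
  "F2 \<equiv> free_group UNIV"

section \<open>Classes of surjective homomorphisms\<close>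

text \<open>
  As in \<^const>\<open>auto\<close>, only extensional functions are taken, so that a homomorphism is determined
  by its values on the carrier.
\<close>

definition Epi :: "('a, 'c) monoid_scheme \<Rightarrow> ('b, 'd) monoid_scheme \<Rightarrow> ('a \<Rightarrow> 'b) set" where
  "Epi F G = epi F G \<inter> extensional (carrier F)"

text \<open>The double quotient of \<open>Epi F G\<close> by \<open>Aut G\<close> (on the left) and \<open>Aut F\<close> (on the right).\<close>

definition Epi_rel :: "('a, 'c) monoid_scheme \<Rightarrow> ('b, 'd) monoid_scheme \<Rightarrow> ('a \<Rightarrow> 'b) rel" where
  "Epi_rel F G = {(f, f'). f \<in> Epi F G \<and> f' \<in> Epi F G \<and>
     (\<exists>\<phi>\<in>auto F. \<exists>\<psi>\<in>auto G. f' = compose (carrier F) \<psi> (compose (carrier F) f \<phi>))}"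

definition Epi_classes ::
    "('a, 'c) monoid_scheme \<Rightarrow> ('b, 'd) monoid_scheme \<Rightarrow> ('a \<Rightarrow> 'b) set set" where
  "Epi_classes F G = Epi F G // Epi_rel F G"

lemma auto_inverse:
  assumes "group G" "\<phi> \<in> auto G"
  shows "\<exists>\<phi>'\<in>auto G. \<forall>x\<in>carrier G. \<phi>' (\<phi> x) = x \<and> \<phi> (\<phi>' x) = x"
proof (intro bexI ballI conjI)
  let ?i = "restrict (inv_into (carrier G) \<phi>) (carrier G)"
  have bij: "bij_betw \<phi> (carrier G) (carrier G)"
    using assms by (auto simp: auto_def Bij_def)
  show "?i \<in> auto G"
    using assms group.restrict_inv_into_hom[OF assms(1)] restrict_inv_into_Bij
    by (auto simp: auto_def)
  show "?i (\<phi> x) = x" if "x \<in> carrier G" for x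
    using that bij by (auto simp: bij_betw_def)
  show "\<phi> (?i x) = x" if "x \<in> carrier G" for x
    using that bij by (simp add: bij_betw_inv_into_right)
qed

lemma auto_closed: "\<phi> \<in> auto G \<Longrightarrow> x \<in> carrier G \<Longrightarrow> \<phi> x \<in> carrier G"
  by (auto simp: auto_def hom_def)

lemma compose_auto:
  assumes "group G" "\<phi> \<in> auto G" "\<psi> \<in> auto G"
  shows "compose (carrier G) \<phi> \<psi> \<in> auto G"
proof -
  have "compose (carrier G) \<phi> \<psi> \<in> hom G G"
    using assms by (intro group.hom_compose) (auto simp: auto_def)
  moreover have "compose (carrier G) \<phi> \<psi> \<in> Bij (carrier G)"
    using assms by (intro compose_Bij) (auto simp: auto_def)
  ultimately show ?thesis
    by (simp add: auto_def)
qed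

lemma equiv_Epi_rel:
  assumes F: "group F" and G: "group G"
  shows "equiv (Epi F G) (Epi_rel F G)"
proof (rule equivI)
  have cl: "f x \<in> carrier G" if "f \<in> Epi F G" "x \<in> carrier F" for f x
    using that by (auto simp: Epi_def epi_def)
  have eqI: "f = f'" if "f \<in> Epi F G" "f' \<in> Epi F G" "\<And>x. x \<in> carrier F \<Longrightarrow> f x = f' x" for f f'
    using that by (auto simp: Epi_def intro: extensionalityI)
  have rel: "(f, f') \<in> Epi_rel F G \<longleftrightarrow> f \<in> Epi F G \<and> f' \<in> Epi F G \<and>
     (\<exists>\<phi>\<in>auto F. \<exists>\<psi>\<in>auto G. \<forall>x\<in>carrier F. f' x = \<psi> (f (\<phi> x)))" for f f'
  proof -
    have "f' = compose (carrier F) \<psi> (compose (carrier F) f \<phi>) \<longleftrightarrow>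
        (\<forall>x\<in>carrier F. f' x = \<psi> (f (\<phi> x)))" if "f' \<in> Epi F G" for \<phi> \<psi>
    proof -
      have "f' \<in> extensional (carrier F)"
        using that by (simp add: Epi_def)
      then have "f' = compose (carrier F) \<psi> (compose (carrier F) f \<phi>) \<longleftrightarrow>
          (\<forall>x\<in>carrier F. f' x = compose (carrier F) \<psi> (compose (carrier F) f \<phi>) x)"
        using extensionalityI[OF _ compose_extensional] by metis
      then show ?thesis
        by (simp add: compose_eq)
    qed
    then show ?thesis
      unfolding Epi_rel_def mem_Collect_eq split_conv by blast
  qed
  show "Epi_rel F G \<subseteq> Epi F G \<times> Epi F G"
    by (auto simp: rel)
  show "refl_on (Epi F G) (Epi_rel F G)"
  proof (rule refl_onI)
    fix f assume "f \<in> Epi F G"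
    then show "(f, f) \<in> Epi_rel F G"
      unfolding rel using cl
      by (intro conjI bexI[OF _ group.id_in_auto[OF F]] bexI[OF _ group.id_in_auto[OF G]]) simp_all
  qed
  show "sym (Epi_rel F G)"
  proof (rule symI)
    fix f f' assume "(f, f') \<in> Epi_rel F G"
    then obtain \<phi> \<psi> where *: "f \<in> Epi F G" "f' \<in> Epi F G" "\<phi> \<in> auto F" "\<psi> \<in> auto G"
      "\<And>x. x \<in> carrier F \<Longrightarrow> f' x = \<psi> (f (\<phi> x))"
      unfolding rel by blast
    obtain \<phi>' where p: "\<phi>' \<in> auto F"
      "\<forall>x\<in>carrier F. \<phi>' (\<phi> x) = x \<and> \<phi> (\<phi>' x) = x"
      using auto_inverse[OF F *(3)] by blast
    obtain \<psi>' where q: "\<psi>' \<in> auto G"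
      "\<forall>x\<in>carrier G. \<psi>' (\<psi> x) = x \<and> \<psi> (\<psi>' x) = x"
      using auto_inverse[OF G *(4)] by blast
    have "f x = \<psi>' (f' (\<phi>' x))" if "x \<in> carrier F" for x
      using that *(1,5) p(2) q(2) cl auto_closed[OF p(1)] auto_closed[OF *(3)] by simp
    then show "(f', f) \<in> Epi_rel F G"
      unfolding rel using *(1,2) by (intro conjI bexI[OF _ p(1)] bexI[OF _ q(1)]) auto
  qed
  show "trans (Epi_rel F G)"
  proof (rule transI)
    fix f f' f'' assume "(f, f') \<in> Epi_rel F G" "(f', f'') \<in> Epi_rel F G"
    then obtain \<phi> \<psi> \<phi>' \<psi>' where *: "f \<in> Epi F G" "f' \<in> Epi F G" "f'' \<in> Epi F G"
      "\<phi> \<in> auto F" "\<psi> \<in> auto G" "\<phi>' \<in> auto F" "\<psi>' \<in> auto G"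
      "\<And>x. x \<in> carrier F \<Longrightarrow> f' x = \<psi> (f (\<phi> x))"
      "\<And>x. x \<in> carrier F \<Longrightarrow> f'' x = \<psi>' (f' (\<phi>' x))"
      unfolding rel by blast
    have "f'' x = compose (carrier G) \<psi>' \<psi> (f (compose (carrier F) \<phi> \<phi>' x))"
      if "x \<in> carrier F" for x
      using that *(1,8,9) cl auto_closed[OF *(4)] auto_closed[OF *(6)] by (simp add: compose_eq)
    then show "(f, f'') \<in> Epi_rel F G"
      unfolding rel using *(1,3)
      by (intro conjI bexI[OF _ compose_auto[OF F *(4,6)]] bexI[OF _ compose_auto[OF G *(7,5)]]) auto
  qed
qed

end

(*
  Encode a surjection f by the pair (f x, f y). The Euclidean algorithm, carried out by Nielsen
  moves, makes the Z/m-component of f y trivial. If f y then lies in the Klein four-group V, then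
  3 does not divide m (otherwise the image in the abelianization would be too small), and
  multiplying f y by (f x)^m moves it out of V without changing its Z/m-component. Multiplying
  f x by powers of f y moves its A_4-component into V. Conjugation in S_4 and a unit of Z/m
  finally take the pair to a fixed one.
*)
theory Submission
  imports Defs
begin

text \<open>Each Nielsen move acts on both components, so the obstacle is to correct one without
  spoiling the other. Once the Z/m-component of f y is 0, multiplying f x by f y leaves the
  Z/m-component of f x alone. In the other direction, (f x)^m has trivial Z/m-component, yet it
  moves f y in the quotient A_4/V = Z/3 when 3 does not divide m, as f x lies outside V whenever f y
  lies in it. If 3 divides m, the abelianization Z/3 x Z/m is not cyclic, whereas f y in V with
  trivial Z/m-component would leave the image of f x as its only generator. The final A_4-component
  of f x is not trivial: otherwise all of A_4 would commute with that of f y. What remains is a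
  double transposition and a three-cycle. There are 3 * 8 = 24 such pairs and S_4 permutes them
  simply transitively by conjugation, so conjugation in A_4 alone would not do. Surjectivity enters
  without counting: a condition stable under the group operations that holds at f x and f y holds
  everywhere, and it is evaluated at an element where it is absurd.\<close>

declare One_nat_def [simp del]

section \<open>The alternating group on four letters\<close>

text \<open>One-line notation. Equality of functions on \<open>nat\<close> cannot be evaluated,
  equality of lists can; all finite facts about A_4 are therefore decided on these lists and carried
  back by \<open>four_inj\<close> and \<open>four_surj\<close>.\<close>

definition four :: "(nat \<Rightarrow> nat) \<Rightarrow> nat list" where
  "four p = map p [1, 2, 3, 4]"

definition comp4 :: "nat list \<Rightarrow> nat list \<Rightarrow> nat list" where
  "comp4 l l' = map (\<lambda>i. l ! (i - 1)) l'"

definition A4_list :: "nat list list" where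
  "A4_list = [[1,2,3,4], [2,1,4,3], [3,4,1,2], [4,3,2,1],
    [2,3,1,4], [3,1,2,4], [3,2,4,1], [4,2,1,3], [2,4,3,1], [4,1,3,2], [1,3,4,2], [1,4,2,3]]"

text \<open>
  \<open>A\<^sub>4\<close> acts on the three partitions of \<open>{1, 2, 3, 4}\<close> into two pairs through its quotient
  \<open>\<int>/3\<close>; the sum of the images of 3 and 4 determines the image of the partition \<open>12|34\<close>.
\<close>
definition chi4 :: "nat list \<Rightarrow> int" where
  "chi4 l = (let s = l ! 2 + l ! 3 in if s = 5 then 1 else if even s then 2 else 0)"

lemma A4_list_comp4: "\<forall>l\<in>set A4_list. \<forall>l'\<in>set A4_list. comp4 l l' \<in> set A4_list"
  by code_simp

lemma A4_list_inv: "\<forall>l\<in>set A4_list. \<exists>l'\<in>set A4_list. comp4 l' l = [1,2,3,4]"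
  by code_simp

lemma chi4_comp4: "\<forall>l\<in>set A4_list. \<forall>l'\<in>set A4_list. chi4 (comp4 l l') = (chi4 l + chi4 l') mod 3"
  by code_simp

lemma chi4_range: "\<forall>l\<in>set A4_list. chi4 l \<in> {0, 1, 2}"
  by code_simp

text \<open>
  For \<open>a\<close> a double transposition and \<open>b\<close> a three-cycle with fixed point \<open>d\<close>, the letters are
  \<open>b (a d), b (b (a d)), a d, d\<close>; sending 1, 2, 3, 4 to them conjugates \<open>(a, b)\<close> to a standard pair.
\<close>
definition conj4 :: "nat list \<Rightarrow> nat list \<Rightarrow> nat list" where
  "conj4 l l' = (let d = hd (filter (\<lambda>i. l' ! (i - 1) = i) [1,2,3,4]);
     c = l ! (d - 1); e = l' ! (c - 1) in [e, l' ! (e - 1), c, d])"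

lemma comp4_conj4:
  "\<forall>l\<in>set (filter (\<lambda>l. chi4 l = 0 \<and> l \<noteq> [1,2,3,4]) A4_list).
   \<forall>l'\<in>set (filter (\<lambda>l. chi4 l \<noteq> 0) A4_list).
     length (conj4 l l') = 4 \<and> set (conj4 l l') = {1,2,3,4} \<and>
     comp4 l (conj4 l l') = comp4 (conj4 l l') [2,1,4,3] \<and>
     comp4 l' (conj4 l l') = comp4 (conj4 l l') [2,3,1,4]"
  by code_simp

lemma A4_list_set: "\<forall>l\<in>set A4_list. length l = 4 \<and> set l = {1,2,3,4}"
  by code_simp

text \<open>In A_4 the centralizer of a double transposition is the Klein four-group, the kernel of
  \<open>chi4\<close>.\<close>

lemma A4_list_commute:
  "\<forall>l\<in>set A4_list. comp4 l [2,1,4,3] = comp4 [2,1,4,3] l \<longrightarrow> chi4 l = 0"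
  by code_simp

lemma atLeastAtMost_1_4: "{1..4} = {1::nat, 2, 3, 4}"
  by auto

lemma four_id [simp]: "four id = [1,2,3,4]"
  by (simp add: four_def)

lemma four_nth: "i \<in> {1, 2, 3, 4} \<Longrightarrow> four p ! (i - 1) = p i"
  by (elim insertE emptyE) (simp_all add: four_def)

lemma four_comp:
  assumes "q permutes {1..4}"
  shows "four (p \<circ> q) = comp4 (four p) (four q)"
proof -
  have "four p ! (q i - 1) = p (q i)" if "i \<in> {1, 2, 3, 4}" for i
    using that permutes_in_image[OF assms, of i] unfolding atLeastAtMost_1_4
    by (intro four_nth) simp
  then show ?thesis
    unfolding comp4_def four_def[of q] four_def[of "p \<circ> q"] by simp
qed

lemma four_inj:
  assumes "p permutes {1..4}" "q permutes {1..4}" "four p = four q"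
  shows "p = q"
proof
  fix i
  show "p i = q i"
  proof (cases "i \<in> {1..4}")
    case True
    then show ?thesis
      using assms(3) unfolding atLeastAtMost_1_4 four_def by (elim insertE emptyE) simp_all
  qed (use assms(1,2) in \<open>simp add: permutes_def\<close>)
qed

lemma four_surj:
  assumes "length s = 4" "set s = {1,2,3,4}"
  obtains p where "p permutes {1..4}" "four p = s"
proof
  \<comment> \<open>The identity outside \<open>{1..4}\<close> is what \<open>permutes\<close>
    demands.\<close>
  let ?p = "\<lambda>i. if i \<in> {1..4} then s ! (i - 1) else i"
  have s: "length s = 4" "set s = {1..4}"
    using assms unfolding atLeastAtMost_1_4 by blast+
  then have "s = [s ! 0, s ! 1, s ! 2, s ! 3]"
    by (auto simp: list_eq_iff_nth_eq less_Suc_eq numeral_eq_Suc One_nat_def)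
  then show f: "four ?p = s"
    by (simp add: four_def One_nat_def)
  have "?p ` {1..4} = set (four ?p)"
    unfolding atLeastAtMost_1_4 four_def by simp
  then have "?p ` {1..4} = {1..4}"
    using f s by simp
  then have "bij_betw ?p {1..4} {1..4}"
    by (simp add: bij_betw_def finite_surj_inj)
  then show "?p permutes {1..4}"
    by (rule bij_imp_permutes) (simp only: if_False)
qed

lemma four_three_cycle:
  "\<forall>a\<in>{1,2,3,4}. \<forall>b\<in>{1,2,3,4}-{a}. \<forall>c\<in>{1,2,3,4}-{a,b}.
    four (cycle_of_list [a, b, c]) \<in> set A4_list"
  by code_simp

section \<open>The group A_4, its character to Z/3 and its standard generators\<close>

abbreviation A4 :: "(nat \<Rightarrow> nat) monoid" where
  "A4 \<equiv> alt_group 4"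

lemma A4_permutes: "p \<in> carrier A4 \<Longrightarrow> p permutes {1..4}"
  by (simp add: alt_group_carrier)

text \<open>The elements found in the table form a subgroup that contains every three-cycle, and the
  three-cycles generate A_4. This avoids evaluating the parity of permutations.\<close>

lemma four_A4:
  assumes "p \<in> carrier A4"
  shows "four p \<in> set A4_list"
proof -
  interpret group A4 by (rule alt_group_is_group)
  let ?S = "{p \<in> carrier A4. four p \<in> set A4_list}"
  have "subgroup ?S A4"
  proof (rule subgroupI)
    have "\<one>\<^bsub>A4\<^esub> \<in> ?S"
      using one_closed by (auto simp: alt_group_one A4_list_def)
    then show "?S \<noteq> {}"
      by blast
    show "a \<otimes>\<^bsub>A4\<^esub> b \<in> ?S" if "a \<in> ?S" "b \<in> ?S" for a b
      using that A4_list_comp4 m_closed[of a b]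
      by (simp add: alt_group_mult four_comp A4_permutes)
    show "inv\<^bsub>A4\<^esub> a \<in> ?S" if a: "a \<in> ?S" for a
    proof -
      let ?b = "inv\<^bsub>A4\<^esub> a"
      have b: "?b \<in> carrier A4" "a \<circ> ?b = id"
        using a r_inv[of a] by (auto simp: alt_group_mult alt_group_one)
      obtain l where l: "l \<in> set A4_list" "comp4 l (four a) = [1,2,3,4]"
        using a A4_list_inv by blast
      obtain p where p: "p permutes {1..4}" "four p = l"
        using four_surj[of l] l(1) A4_list_set by blast
      have "four (p \<circ> a) = four id"
        using l(2) p(2) a by (simp add: four_comp A4_permutes)
      then have "p \<circ> a = id"
        using a p(1) by (intro four_inj permutes_compose permutes_id) (auto intro: A4_permutes)
      then have "p = ?b"
        using b(2) by (metis comp_assoc comp_id id_comp)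
      then show ?thesis
        using b(1) p(2) l(1) by simp
    qed
  qed auto
  moreover have "three_cycles 4 \<subseteq> ?S"
  proof
    fix p assume p: "p \<in> three_cycles 4"
    then obtain cs where cs: "p = cycle_of_list cs" "distinct cs" "length cs = 3" "set cs \<subseteq> {1..4}"
      by blast
    then obtain a b c where abc: "cs = [a, b, c]"
      by (auto simp: numeral_eq_Suc length_Suc_conv)
    have "{a, b, c} \<subseteq> {1, 2, 3, 4}" "a \<noteq> b" "a \<noteq> c" "b \<noteq> c"
      using cs abc unfolding atLeastAtMost_1_4 by simp_all
    then have "a \<in> {1, 2, 3, 4}" "b \<in> {1, 2, 3, 4} - {a}" "c \<in> {1, 2, 3, 4} - {a, b}"
      by blast+
    then have "four p \<in> set A4_list"
      unfolding cs(1) abc using four_three_cycle by blast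
    then show "p \<in> ?S"
      using subsetD[OF three_cycles_incl p] by blast
  qed
  ultimately show ?thesis
    using assms generate_subgroup_incl alt_group_carrier_as_three_cycles[of 4] by blast
qed

text \<open>On A_4 this is the abelianization map to Z/3 with representatives 0, 1, 2. Its kernel is
  the Klein four-group, so \<open>chi p = 0\<close> expresses membership in V.\<close>

definition chi :: "(nat \<Rightarrow> nat) \<Rightarrow> int" where
  "chi p = chi4 (four p)"

lemma chi_comp: "p \<in> carrier A4 \<Longrightarrow> q \<in> carrier A4 \<Longrightarrow> chi (p \<circ> q) = (chi p + chi q) mod 3"
  using chi4_comp4 four_A4 by (simp add: chi_def four_comp A4_permutes)

lemma chi_range: "p \<in> carrier A4 \<Longrightarrow> chi p \<in> {0, 1, 2}"
  using chi4_range four_A4 by (simp add: chi_def)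

text \<open>This is (1 2)(3 4), written as a product of three-cycles so that membership in A_4
  follows from \<open>three_cycles_incl\<close>.\<close>

definition a0 :: "nat \<Rightarrow> nat" where "a0 = cycle_of_list [1, 2, 3] \<circ> cycle_of_list [2, 3, 4]"
definition b0 :: "nat \<Rightarrow> nat" where "b0 = cycle_of_list [1, 2, 3]"

lemma four_a0: "four a0 = [2,1,4,3]" and four_b0: "four b0 = [2,3,1,4]"
  by (simp_all add: four_def a0_def b0_def transpose_def)

lemma chi_b0: "chi b0 = 1"
  by (simp add: chi_def four_b0 chi4_def)

lemma b0_A4: "b0 \<in> carrier A4"
  using three_cycles_incl[of 4] by (rule subsetD) (auto simp: b0_def intro!: exI[of _ "[1, 2, 3]"])

lemma a0_A4: "a0 \<in> carrier A4"
proof -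
  have "cycle_of_list [2, 3, 4] \<in> carrier A4"
    using three_cycles_incl[of 4] by (rule subsetD) (auto intro!: exI[of _ "[2, 3, 4]"])
  then show ?thesis
    using monoid.m_closed[OF group.is_monoid[OF alt_group_is_group] b0_A4]
    by (auto simp: alt_group_mult a0_def b0_def)
qed

lemma A4_conj:
  assumes "a \<in> carrier A4" "b \<in> carrier A4" "chi a = 0" "a \<noteq> id" "chi b \<noteq> 0"
  obtains t where "t permutes {1..4}" "a \<circ> t = t \<circ> a0" "b \<circ> t = t \<circ> b0"
proof -
  have "four a \<noteq> [1,2,3,4]"
    using assms four_inj[of a id] A4_permutes permutes_id by force
  then have "four a \<in> set (filter (\<lambda>l. chi4 l = 0 \<and> l \<noteq> [1,2,3,4]) A4_list)"
    "four b \<in> set (filter (\<lambda>l. chi4 l \<noteq> 0) A4_list)"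
    using assms four_A4 by (auto simp: chi_def)
  then obtain l where l: "length l = 4" "set l = {1,2,3,4}"
    "comp4 (four a) l = comp4 l [2,1,4,3]" "comp4 (four b) l = comp4 l [2,3,1,4]"
    using comp4_conj4 by blast
  obtain t where t: "t permutes {1..4}" "four t = l"
    using four_surj[OF l(1,2)] .
  show ?thesis
  proof
    show "a \<circ> t = t \<circ> a0" "b \<circ> t = t \<circ> b0"
      using assms(1,2) t a0_A4 b0_A4 l(3,4)
      by (auto intro!: four_inj permutes_compose simp: A4_permutes four_comp four_a0 four_b0)
  qed fact
qed

lemma commute_a0: "b \<in> carrier A4 \<Longrightarrow> b \<circ> a0 = a0 \<circ> b \<Longrightarrow> chi b = 0"
  using A4_list_commute four_A4 four_comp[of a0 b] four_comp[of b a0]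
  by (metis A4_permutes a0_A4 chi_def four_a0)

text \<open>Odd \<open>s\<close> must be allowed, since the conjugator supplied by
  \<open>A4_conj\<close> may be odd.\<close>

lemma conj_iso_A4:
  assumes "s permutes {1..4}"
  shows "(\<lambda>p. s \<circ> p \<circ> inv' s) \<in> iso A4 A4"
proof -
  have i: "inv' s permutes {1..4}" "inv' s \<circ> s = id" "s \<circ> inv' s = id"
    using assms permutes_inv permutes_inv_o by blast+
  have cl: "t \<circ> p \<circ> inv' t \<in> carrier A4" if "t permutes {1..4}" "p \<in> carrier A4" for t p
  proof -
    have "permutation t" "permutation p" "permutation (inv' t)"
      using that permutation_permutes permutes_inv by (blast intro: alt_group_carrier')+
    then show ?thesis
      using that by (simp add: alt_group_carrier permutes_compose permutes_inv evenperm_comp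
          evenperm_inv permutation_compose)
  qed
  have 1: "s \<circ> p \<circ> inv' s \<circ> (s \<circ> q \<circ> inv' s) = s \<circ> (p \<circ> q) \<circ> inv' s" for p q
    using i(2) by (metis comp_assoc comp_id)
  have ii: "inv' (inv' s) = s"
    by (rule permutes_inv_inv[OF assms])
  have bij: "bij_betw (\<lambda>p. s \<circ> p \<circ> inv' s) (carrier A4) (carrier A4)"
  proof (rule bij_betw_byWitness[where f' = "\<lambda>p. inv' s \<circ> p \<circ> s"])
    show "\<forall>p\<in>carrier A4. inv' s \<circ> (s \<circ> p \<circ> inv' s) \<circ> s = p"
      "\<forall>p\<in>carrier A4. s \<circ> (inv' s \<circ> p \<circ> s) \<circ> inv' s = p"
      using i(2,3) by (metis comp_assoc comp_id id_comp)+
    show "(\<lambda>p. s \<circ> p \<circ> inv' s) ` carrier A4 \<subseteq> carrier A4"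
      using cl[OF assms] by auto
    show "(\<lambda>p. inv' s \<circ> p \<circ> s) ` carrier A4 \<subseteq> carrier A4"
      using cl[OF i(1)] ii by auto
  qed
  show ?thesis
    using bij cl[OF assms] 1 by (intro isoI homI) (simp_all add: alt_group_mult)
qed

text \<open>Each element of \<open>A\<^sub>4\<close> is \<open>v b\<^sub>0\<^sup>k\<close> with \<open>v\<close> in the Klein four-group, which is generated by
  \<open>a\<^sub>0\<close> and its conjugate by \<open>b\<^sub>0\<close>.\<close>
lemma A4_generated:
  assumes P: "P a0" "P b0" "P id" "\<And>p q. p \<in> carrier A4 \<Longrightarrow> q \<in> carrier A4 \<Longrightarrow> P p \<Longrightarrow> P q \<Longrightarrow> P (p \<circ> q)"
    and p: "p \<in> carrier A4"
  shows "P p"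
proof -
  interpret group A4 by (rule alt_group_is_group)
  have cl: "p \<circ> q \<in> carrier A4" if "p \<in> carrier A4" "q \<in> carrier A4" for p q
    using m_closed[OF that] by (simp add: alt_group_mult)
  define Q where "Q l \<longleftrightarrow> (\<exists>p\<in>carrier A4. P p \<and> four p = l)" for l
  have Q: "Q [1,2,3,4]" "Q [2,1,4,3]" "Q [2,3,1,4]"
    unfolding Q_def using P(1-3) a0_A4 b0_A4 one_closed four_a0 four_b0
    by (auto simp: alt_group_one)
  have Qc: "Q (comp4 l l')" if "Q l" "Q l'" for l l'
    using that cl P(4) unfolding Q_def by (metis A4_permutes four_comp)
  have Q1: "Q [3,1,2,4]"
    using Qc[OF Q(3) Q(3)] by (simp add: comp4_def)
  \<comment> \<open>This list is the product of \<open>a0\<close> and \<open>b0\<close>. Multiplying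
    on the left by the square of \<open>b0\<close>, which is its inverse, gives the conjugate
    \<open>[3,4,1,2]\<close> of \<open>a0\<close>.\<close>
  have "Q [1,4,2,3]"
    using Qc[OF Q(2) Q(3)] by (simp add: comp4_def)
  then have Q2: "Q [3,4,1,2]"
    using Qc[OF Q1] by (fastforce simp: comp4_def)
  have Q3: "Q [4,3,2,1]"
    using Qc[OF Q(2) Q2] by (simp add: comp4_def)
  note V = Q(1,2) Q2 Q3
  have "Q l" if "l \<in> set A4_list" for l
    using that V[THEN Qc, OF Q(3)] V[THEN Qc, OF Q1] V
    by (auto simp: comp4_def A4_list_def)
  then obtain q where "q \<in> carrier A4" "P q" "four q = four p"
    using four_A4[OF p] unfolding Q_def by blast
  then show ?thesis
    using four_inj[of q p] p A4_permutes by simp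
qed

section \<open>Nielsen moves\<close>

lemma auto_restrictI:
  assumes "group G" and h: "h \<in> hom G G" and k: "k \<in> carrier G \<rightarrow> carrier G"
    and "\<And>x. x \<in> carrier G \<Longrightarrow> k (h x) = x" "\<And>x. x \<in> carrier G \<Longrightarrow> h (k x) = x"
  shows "restrict h (carrier G) \<in> auto G"
proof -
  have "h \<in> carrier G \<rightarrow> carrier G"
    using h by (simp add: hom_def)
  then have "bij_betw h (carrier G) (carrier G)"
    using assms by (intro bij_betwI[where g = k]) auto
  moreover have "restrict h (carrier G) \<in> hom G G"
    by (rule group.hom_restrict[OF assms(1) h]) simp
  ultimately show ?thesis
    by (simp add: auto_def Bij_def)
qed

section \<open>Automorphisms of F_2 given by substitution\<close>

lemma free_gen_F2 [simp]: "free_gen s \<in> carrier F2"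
  by (rule free_gen_in_carrier) simp

(* An unqualified X would be parsed as the indeterminate of the polynomial rings of HOL-Algebra. *)
lemma F2_hom_eqI:
  assumes "group H" "h \<in> hom F2 H" "k \<in> hom F2 H"
    and "h (free_gen xy.X) = k (free_gen xy.X)" "h (free_gen Y) = k (free_gen Y)"
    and "w \<in> carrier F2"
  shows "h w = k w"
proof -
  have "h (free_gen s) = k (free_gen s)" for s
    using assms(4,5) by (cases s) simp_all
  moreover have "(\<lambda>s. k (free_gen s)) \<in> UNIV \<rightarrow> carrier H"
    using assms(3) by (auto simp: hom_def)
  ultimately show ?thesis
    using free_eval_unique[of H "\<lambda>s. k (free_gen s)" UNIV] assms by metis
qed

text \<open>An explicit inverse lets the Nielsen moves be verified by rewriting words.\<close>

lemma inv_free_group: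
  "w \<in> carrier (free_group S) \<Longrightarrow> inv\<^bsub>free_group S\<^esub> w = rev (map inv_letter w)"
  by (intro group.inv_equality[OF group_free_group])
    (simp_all add: carrier_free_group mult_free_group one_free_group reduced_mult_inv
      reduced_rev reduced_map_inv_letter image_image)

abbreviation F2_subst :: "xy word \<Rightarrow> xy word \<Rightarrow> xy word \<Rightarrow> xy word" where
  "F2_subst u v \<equiv> free_eval F2 (\<lambda>s. case s of xy.X \<Rightarrow> u | Y \<Rightarrow> v)"

lemma F2_subst_hom:
  assumes "u \<in> carrier F2" "v \<in> carrier F2"
  shows "F2_subst u v \<in> hom F2 F2" "F2_subst u v (free_gen xy.X) = u" "F2_subst u v (free_gen Y) = v"
proof -
  have e: "(\<lambda>s. case s of xy.X \<Rightarrow> u | Y \<Rightarrow> v) \<in> UNIV \<rightarrow> carrier F2"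
    using assms by (auto split: xy.split)
  show "F2_subst u v \<in> hom F2 F2"
    by (rule free_eval_hom[OF group_free_group e])
  show "F2_subst u v (free_gen xy.X) = u" "F2_subst u v (free_gen Y) = v"
    using free_eval_gen[OF group_free_group e] by simp_all
qed

text \<open>The composite and the identity are endomorphisms of \<open>F2\<close>, so comparing them
  on the two generators is enough.\<close>

lemma F2_subst_inverse:
  assumes "u \<in> carrier F2" "v \<in> carrier F2" "u' \<in> carrier F2" "v' \<in> carrier F2"
    and "F2_subst u' v' u = free_gen xy.X" "F2_subst u' v' v = free_gen Y" "w \<in> carrier F2"
  shows "F2_subst u' v' (F2_subst u v w) = w"
proof -
  have 1: "(\<lambda>w. F2_subst u' v' (F2_subst u v w)) \<in> hom F2 F2"
    using hom_compose[OF F2_subst_hom(1)[OF assms(1,2)] F2_subst_hom(1)[OF assms(3,4)]]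
    by (simp add: comp_def)
  have 2: "(\<lambda>w. w) \<in> hom F2 F2"
    by (simp add: hom_def)
  show ?thesis
    using F2_hom_eqI[OF group_free_group 1 2 _ _ assms(7)] assms by (simp add: F2_subst_hom)
qed

lemma F2_subst_auto:
  assumes "u \<in> carrier F2" "v \<in> carrier F2" "u' \<in> carrier F2" "v' \<in> carrier F2"
    and "F2_subst u' v' u = free_gen xy.X" "F2_subst u' v' v = free_gen Y"
    and "F2_subst u v u' = free_gen xy.X" "F2_subst u v v' = free_gen Y"
  shows "restrict (F2_subst u v) (carrier F2) \<in> auto F2"
  using F2_subst_hom(1)[OF assms(1,2)] F2_subst_hom(1)[OF assms(3,4)] assms
  by (intro auto_restrictI[where k = "F2_subst u' v'"] group_free_group F2_subst_inverse)
    (auto simp: hom_def)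

text \<open>A surjection is determined by the images of the generators, so the class of
  \<open>f\<close> is recorded as a set of pairs. Two classes coincide once their sets share a
  single pair (\<open>epi_pairs_Epi_rel\<close>), which reduces uniqueness to reaching one fixed
  pair from every \<open>f\<close>.\<close>

definition epi_pairs :: "('a, 'c) monoid_scheme \<Rightarrow> (xy word \<Rightarrow> 'a) \<Rightarrow> ('a \<times> 'a) set" where
  "epi_pairs G f = {(f' (free_gen xy.X), f' (free_gen Y)) | f'. (f, f') \<in> Epi_rel F2 G}"

lemma Epi_relI:
  assumes "group F" "group G" "f \<in> Epi F G" "\<phi> \<in> auto F" "\<psi> \<in> auto G"
  shows "(f, compose (carrier F) \<psi> (compose (carrier F) f \<phi>)) \<in> Epi_rel F G"
proof -
  let ?g = "compose (carrier F) \<psi> (compose (carrier F) f \<phi>)"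
  have h: "f \<in> hom F G" "\<phi> \<in> hom F F" "\<psi> \<in> hom G G"
    "f ` carrier F = carrier G" "\<phi> ` carrier F = carrier F" "\<psi> ` carrier G = carrier G"
    using assms by (auto simp: Epi_def epi_def auto_def Bij_def bij_betw_def)
  have "?g x = (\<psi> \<circ> (f \<circ> \<phi>)) x" if "x \<in> carrier F" for x
    using that by (simp add: compose_eq)
  moreover have "\<psi> \<circ> (f \<circ> \<phi>) \<in> hom F G"
    using h by (intro hom_compose)
  ultimately have "?g \<in> hom F G"
    using group.hom_restrict[OF assms(1)] by metis
  moreover have "?g ` carrier F = \<psi> ` f ` \<phi> ` carrier F"
    by (force simp: compose_eq image_iff)
  ultimately have "?g \<in> Epi F G"
    using h by (simp add: Epi_def epi_def)
  then show ?thesis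
    using assms by (auto simp: Epi_rel_def)
qed

lemma Epi_hom: "f \<in> Epi F G \<Longrightarrow> f \<in> hom F G"
  by (simp add: Epi_def epi_def)

lemma Epi_F2_eqI:
  assumes "group G" "f \<in> Epi F2 G" "g \<in> Epi F2 G"
    "f (free_gen xy.X) = g (free_gen xy.X)" "f (free_gen Y) = g (free_gen Y)"
  shows "f = g"
proof (rule extensionalityI)
  show "f \<in> extensional (carrier F2)" "g \<in> extensional (carrier F2)"
    using assms by (simp_all add: Epi_def)
  show "f w = g w" if "w \<in> carrier F2" for w
    using F2_hom_eqI[OF assms(1) assms(2,3)[THEN Epi_hom] assms(4,5) that] .
qed

section \<open>Moves on generating pairs\<close>

context
  fixes G (structure) and f
  assumes G: "group G" and f: "f \<in> Epi F2 G"
begin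

interpretation group G by (rule G)
interpretation F: group F2 by (rule group_free_group)

lemma epi_pairs_self: "(f (free_gen xy.X), f (free_gen Y)) \<in> epi_pairs G f"
  using equiv_Epi_rel[OF F.is_group G] f unfolding epi_pairs_def equiv_def refl_on_def by blast

lemma epi_pairsE:
  assumes "(p, q) \<in> epi_pairs G f"
  obtains g where "(f, g) \<in> Epi_rel F2 G" "g \<in> Epi F2 G" "group_hom F2 G g"
    "p = g (free_gen xy.X)" "q = g (free_gen Y)"
  using assms unfolding epi_pairs_def
  by (auto simp: Epi_rel_def Epi_hom group_hom_def group_hom_axioms_def F.is_group is_group)

lemma epi_pairs_closed:
  assumes "(p, q) \<in> epi_pairs G f"
  shows "p \<in> carrier G" "q \<in> carrier G"
  using epi_pairsE[OF assms] free_gen_F2 group_hom.hom_closed by metis+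

lemma epi_pairs_step:
  assumes "(f, g) \<in> Epi_rel F2 G" "g \<in> Epi F2 G" "\<phi> \<in> auto F2" "\<psi> \<in> auto G"
  shows "(\<psi> (g (\<phi> (free_gen xy.X))), \<psi> (g (\<phi> (free_gen Y)))) \<in> epi_pairs G f"
proof -
  let ?g = "compose (carrier F2) \<psi> (compose (carrier F2) g \<phi>)"
  have "(f, ?g) \<in> Epi_rel F2 G"
    using Epi_relI[OF F.is_group G assms(2-4)] assms(1) equiv_Epi_rel[OF F.is_group G]
    by (meson equivE transE)
  then show ?thesis
    unfolding epi_pairs_def by (auto intro!: exI[of _ ?g] simp: compose_eq)
qed

lemma epi_pairs_auto:
  assumes "(p, q) \<in> epi_pairs G f" "\<psi> \<in> auto G"
  shows "(\<psi> p, \<psi> q) \<in> epi_pairs G f"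
  using epi_pairsE[OF assms(1)] epi_pairs_step[OF _ _ F.id_in_auto assms(2)] free_gen_F2
  by (metis restrict_apply')

lemma epi_pairs_subst:
  assumes "(p, q) \<in> epi_pairs G f" "restrict (F2_subst u v) (carrier F2) \<in> auto F2"
    "u \<in> carrier F2" "v \<in> carrier F2"
  obtains g where "group_hom F2 G g" "p = g (free_gen xy.X)" "q = g (free_gen Y)"
    "(g u, g v) \<in> epi_pairs G f"
proof -
  obtain g where g: "(f, g) \<in> Epi_rel F2 G" "g \<in> Epi F2 G" "group_hom F2 G g"
    "p = g (free_gen xy.X)" "q = g (free_gen Y)"
    using epi_pairsE[OF assms(1)] by blast
  have "g u \<in> carrier G" "g v \<in> carrier G"
    using g(3) assms(3,4) by (auto intro: group_hom.hom_closed)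
  then have "(g u, g v) \<in> epi_pairs G f"
    using epi_pairs_step[OF g(1,2) assms(2) id_in_auto] assms(3,4) by (simp add: F2_subst_hom)
  then show ?thesis
    using that g by blast
qed

lemma epi_pairs_mult:
  assumes "(p, q) \<in> epi_pairs G f"
  shows "(p \<otimes> q, q) \<in> epi_pairs G f"
proof -
  \<comment> \<open>The substitutions sending x to xy and to xy^-1, both fixing y, are inverse to
    each other; \<open>epi_pairs_div\<close> uses the same two words in exchanged roles.\<close>
  let ?u = "free_gen xy.X \<otimes>\<^bsub>F2\<^esub> free_gen Y" and ?v = "free_gen xy.X \<otimes>\<^bsub>F2\<^esub> inv\<^bsub>F2\<^esub> free_gen Y"
  have "restrict (F2_subst ?u (free_gen Y)) (carrier F2) \<in> auto F2"
    by (rule F2_subst_auto[where u' = ?v and v' = "free_gen Y"])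
      (simp_all, simp_all add: carrier_free_group mult_free_group one_free_group
        inv_free_group free_eval_def free_gen_def reduced_mult_def inv_letter_def)
  then obtain g where g: "group_hom F2 G g" "p = g (free_gen xy.X)" "q = g (free_gen Y)"
    "(g ?u, g (free_gen Y)) \<in> epi_pairs G f"
    using epi_pairs_subst[OF assms] F.m_closed free_gen_F2 by metis
  then show ?thesis
    by (simp add: group_hom.hom_mult)
qed

lemma epi_pairs_div:
  assumes "(p, q) \<in> epi_pairs G f"
  shows "(p \<otimes> inv q, q) \<in> epi_pairs G f"
proof -
  let ?u = "free_gen xy.X \<otimes>\<^bsub>F2\<^esub> free_gen Y" and ?v = "free_gen xy.X \<otimes>\<^bsub>F2\<^esub> inv\<^bsub>F2\<^esub> free_gen Y"
  have "restrict (F2_subst ?v (free_gen Y)) (carrier F2) \<in> auto F2"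
    by (rule F2_subst_auto[where u' = ?u and v' = "free_gen Y"])
      (simp_all, simp_all add: carrier_free_group mult_free_group one_free_group
        inv_free_group free_eval_def free_gen_def reduced_mult_def inv_letter_def)
  then obtain g where g: "group_hom F2 G g" "p = g (free_gen xy.X)" "q = g (free_gen Y)"
    "(g ?v, g (free_gen Y)) \<in> epi_pairs G f"
    using epi_pairs_subst[OF assms] F.m_closed F.inv_closed free_gen_F2 by metis
  then show ?thesis
    by (simp add: group_hom.hom_mult group_hom.hom_inv)
qed

lemma epi_pairs_swap:
  assumes "(p, q) \<in> epi_pairs G f"
  shows "(q, p) \<in> epi_pairs G f"
proof -
  have "restrict (F2_subst (free_gen Y) (free_gen xy.X)) (carrier F2) \<in> auto F2"
    by (rule F2_subst_auto[where u' = "free_gen Y" and v' = "free_gen xy.X"]) (simp_all add: F2_subst_hom)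
  then show ?thesis
    using epi_pairs_subst[OF assms] free_gen_F2 by metis
qed

text \<open>Every pair in the orbit again comes from a surjection. By the universal property its
  values are words in \<open>p\<close> and \<open>q\<close>, and these stay in
  \<open>S\<close>.\<close>

lemma epi_pairs_generate:
  assumes "(p, q) \<in> epi_pairs G f" "subgroup S G" "p \<in> S" "q \<in> S"
  shows "S = carrier G"
proof -
  obtain g where g: "g \<in> Epi F2 G" "group_hom F2 G g" "p = g (free_gen xy.X)" "q = g (free_gen Y)"
    using epi_pairsE[OF assms(1)] by blast
  let ?e = "\<lambda>s. case s of xy.X \<Rightarrow> p | Y \<Rightarrow> q"
  have e: "?e \<in> UNIV \<rightarrow> carrier G"
    using epi_pairs_closed[OF assms(1)] by (simp add: Pi_iff split: xy.split)
  have gen: "g (free_gen s) = ?e s" for s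
    using g(3,4) by (cases s) simp_all
  have "g w \<in> S" if "w \<in> carrier F2" for w
  proof -
    have "g w = free_eval G ?e w"
      by (rule free_eval_unique[OF G e Epi_hom[OF g(1)] gen that])
    also have "\<dots> \<in> S"
    proof (induction w)
      case Nil
      show ?case
        using subgroup.one_closed[OF assms(2)] by (simp add: free_eval_Nil)
    next
      case (Cons a w)
      have "?e (fst a) \<in> S"
        using assms(3,4) by (cases "fst a") simp_all
      then show ?case
        unfolding free_eval_Cons using Cons
        by (simp add: subgroup.m_closed[OF assms(2)] subgroup.m_inv_closed[OF assms(2)])
    qed
    finally show ?thesis .
  qed
  then have "g ` carrier F2 \<subseteq> S"
    by (rule image_subsetI)
  moreover have "g ` carrier F2 = carrier G"
    using g(1) by (simp add: Epi_def epi_def)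
  ultimately show ?thesis
    using subgroup.subset[OF assms(2)] by (simp add: subset_antisym)
qed

end

lemma epi_pairs_Epi_rel:
  assumes "group G" "f \<in> Epi F2 G" "f' \<in> Epi F2 G" "pq \<in> epi_pairs G f" "pq \<in> epi_pairs G f'"
  shows "(f, f') \<in> Epi_rel F2 G"
proof -
  obtain g g' where g: "(f, g) \<in> Epi_rel F2 G" "(f', g') \<in> Epi_rel F2 G"
    "g (free_gen xy.X) = g' (free_gen xy.X)" "g (free_gen Y) = g' (free_gen Y)"
    using assms(4,5) unfolding epi_pairs_def by auto
  then have "g = g'"
    using assms(1) by (intro Epi_F2_eqI) (auto simp: Epi_rel_def)
  then show ?thesis
    using g equiv_Epi_rel[OF group_free_group assms(1)] by (meson equivE symE transE)
qed

lemma Epi_F2_exists: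
  assumes G: "group G" and pq: "p \<in> carrier G" "q \<in> carrier G"
    and gen: "\<And>S. subgroup S G \<Longrightarrow> p \<in> S \<Longrightarrow> q \<in> S \<Longrightarrow> carrier G \<subseteq> S"
  shows "Epi F2 G \<noteq> {}"
proof -
  have g: "(\<lambda>s. case s of xy.X \<Rightarrow> p | Y \<Rightarrow> q) \<in> UNIV \<rightarrow> carrier G"
    using pq by (auto split: xy.split)
  have "\<exists>e. e \<in> hom F2 G \<and> e (free_gen xy.X) = p \<and> e (free_gen Y) = q"
    by (intro exI conjI, rule free_eval_hom[OF G g]) (simp_all add: free_eval_gen[OF G g])
  then obtain e where hom: "e \<in> hom F2 G" and e: "e (free_gen xy.X) = p" "e (free_gen Y) = q"
    by blast
  have p: "p \<in> e ` carrier F2" and q: "q \<in> e ` carrier F2"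
    using e imageI[OF free_gen_F2, of e] by metis+
  interpret group_hom F2 G e
    using hom G by (simp add: group_hom_def group_hom_axioms_def group_free_group)
  have "e ` carrier F2 = carrier G"
    using gen[OF img_is_subgroup p q] subgroup.subset[OF img_is_subgroup] by (rule equalityI[rotated])
  moreover have "restrict e (carrier F2) \<in> hom F2 G"
    by (rule group.hom_restrict[OF group_free_group hom]) simp
  ultimately have "restrict e (carrier F2) \<in> Epi F2 G"
    by (simp add: Epi_def epi_def)
  then show ?thesis
    by (metis empty_iff)
qed

section \<open>Reduction to a standard pair\<close>

abbreviation A4Z :: "nat \<Rightarrow> ((nat \<Rightarrow> nat) \<times> int) monoid" where
  "A4Z m \<equiv> alt_group 4 \<times>\<times> integer_mod_group m"

lemma group_A4Z: "group (A4Z m)"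
  by (simp add: DirProd_group alt_group_is_group)

lemma carrier_A4Z:
  "m \<ge> 1 \<Longrightarrow> (a, u) \<in> carrier (A4Z m) \<longleftrightarrow> a \<in> carrier A4 \<and> 0 \<le> u \<and> u < int m"
  by (auto simp: carrier_integer_mod_group)

lemma mult_A4Z: "(a, u) \<otimes>\<^bsub>A4Z m\<^esub> (b, v) = (a \<circ> b, (u + v) mod int m)"
  by (simp add: alt_group_mult)

lemma inv_A4Z:
  assumes "(a, u) \<in> carrier (A4Z m)"
  shows "inv\<^bsub>A4Z m\<^esub> (a, u) = (inv' a, (- u) mod int m)"
  using assms inv_DirProd[OF alt_group_is_group group_integer_mod_group]
  by (simp add: alt_group_inv_equality)

lemma chi_inv:
  assumes "a \<in> carrier A4"
  shows "chi (inv' a) = (- chi a) mod 3"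
proof -
  have "a \<circ> inv' a = id"
    using A4_permutes[OF assms] permutes_inv_o(1) by blast
  then have "(chi a + chi (inv' a)) mod 3 = 0"
    using chi_comp[OF assms alt_group_inv_closed[OF assms]] by (simp add: chi_def chi4_def)
  then show ?thesis
    using chi_range[OF assms] chi_range[OF alt_group_inv_closed[OF assms]] by auto
qed

text \<open>The curried predicate turns the closure conditions into statements about composition and
  residues, free of the product group.\<close>

lemma subgroup_A4Z:
  assumes "m \<ge> 1" and "P id 0"
    and "\<And>a b u v. a \<in> carrier A4 \<Longrightarrow> b \<in> carrier A4 \<Longrightarrow> P a u \<Longrightarrow> P b v \<Longrightarrow> P (a \<circ> b) ((u + v) mod int m)"
    and "\<And>a u. a \<in> carrier A4 \<Longrightarrow> P a u \<Longrightarrow> P (inv' a) ((- u) mod int m)"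
  shows "subgroup {x \<in> carrier (A4Z m). P (fst x) (snd x)} (A4Z m)"
proof -
  interpret group "A4Z m"
    by (rule group_A4Z)
  show ?thesis
  proof (rule subgroupI)
    have "(id, 0) \<in> {x \<in> carrier (A4Z m). P (fst x) (snd x)}"
      using assms(2) one_closed by (simp add: alt_group_one)
    then show "{x \<in> carrier (A4Z m). P (fst x) (snd x)} \<noteq> {}"
      by blast
  next
    fix x assume x: "x \<in> {x \<in> carrier (A4Z m). P (fst x) (snd x)}"
    obtain a u where au: "x = (a, u)"
      by fastforce
    have "a \<in> carrier A4" "P a u"
      using x by (auto simp: au)
    then show "inv\<^bsub>A4Z m\<^esub> x \<in> {x \<in> carrier (A4Z m). P (fst x) (snd x)}"
      using assms(4) inv_closed[of x] x inv_A4Z[of a u m] unfolding au by auto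
  next
    fix x y
    assume x: "x \<in> {x \<in> carrier (A4Z m). P (fst x) (snd x)}"
      and y: "y \<in> {x \<in> carrier (A4Z m). P (fst x) (snd x)}"
    obtain a u b v where e: "x = (a, u)" "y = (b, v)"
      by fastforce
    have "a \<in> carrier A4" "P a u" "b \<in> carrier A4" "P b v"
      using x y by (auto simp: e)
    then show "x \<otimes>\<^bsub>A4Z m\<^esub> y \<in> {x \<in> carrier (A4Z m). P (fst x) (snd x)}"
      using assms(3) m_closed[of x y] x y mult_A4Z[of m a u b v] unfolding e by auto
  qed auto
qed

section \<open>Normalizing a generating pair of A_4 x Z/m\<close>

context
  fixes m :: nat and f
  assumes m: "m \<ge> 1" and f: "f \<in> Epi F2 (A4Z m)"
begin

abbreviation (input) EP where "EP \<equiv> epi_pairs (A4Z m) f"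

lemma EP_closed:
  assumes "((a, u), (b, v)) \<in> EP"
  shows "a \<in> carrier A4" "b \<in> carrier A4" "0 \<le> u" "u < int m" "0 \<le> v" "v < int m"
  using epi_pairs_closed[OF group_A4Z f assms] carrier_A4Z[OF m] by blast+

lemma EP_swap: "((a, u), (b, v)) \<in> EP \<Longrightarrow> ((b, v), (a, u)) \<in> EP"
  by (rule epi_pairs_swap[OF group_A4Z f])

lemma EP_mult: "((a, u), (b, v)) \<in> EP \<Longrightarrow> ((a \<circ> b, (u + v) mod int m), (b, v)) \<in> EP"
  using epi_pairs_mult[OF group_A4Z f, of "(a, u)" "(b, v)"] unfolding mult_A4Z .

lemma EP_div:
  assumes "((a, u), (b, v)) \<in> EP"
  shows "((a \<circ> inv' b, (u - v) mod int m), (b, v)) \<in> EP"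
  using epi_pairs_div[OF group_A4Z f assms] epi_pairs_closed(2)[OF group_A4Z f assms]
  by (simp only: inv_A4Z mult_A4Z mod_add_right_eq) simp

text \<open>This is how surjectivity is exploited: \<open>P\<close> is chosen to hold at both
  entries of the pair, and the conclusion is read at an element such as \<open>(b0, 0)\<close> where
  it yields a contradiction or a divisibility.\<close>

lemma EP_all:
  assumes "((a, u), (b, v)) \<in> EP" "P id 0"
    and "\<And>a b u v. a \<in> carrier A4 \<Longrightarrow> b \<in> carrier A4 \<Longrightarrow> P a u \<Longrightarrow> P b v \<Longrightarrow> P (a \<circ> b) ((u + v) mod int m)"
    and "\<And>a u. a \<in> carrier A4 \<Longrightarrow> P a u \<Longrightarrow> P (inv' a) ((- u) mod int m)"
    and "P a u" "P b v"
    and "g \<in> carrier A4" "0 \<le> k" "k < int m"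
  shows "P g k"
proof -
  let ?S = "{x \<in> carrier (A4Z m). P (fst x) (snd x)}"
  have "?S = carrier (A4Z m)"
    using epi_pairs_generate[OF group_A4Z f assms(1) subgroup_A4Z[OF m, of P, OF assms(2-4)]]
      epi_pairs_closed[OF group_A4Z f assms(1)] assms(5,6) by simp
  moreover have "(g, k) \<in> carrier (A4Z m)"
    using assms(7-9) carrier_A4Z[OF m] by blast
  ultimately have "(g, k) \<in> ?S"
    by simp
  then show ?thesis
    by simp
qed

text \<open>On representatives in the range from 0 to m - 1, subtracting a smaller positive residue
  from a larger one never wraps around, so \<open>u + v\<close> strictly decreases. The surviving
  residue need not be 1; \<open>EP_coprime\<close> shows that it is a unit.\<close>

lemma EP_euclid:
  assumes "((a, u), (b, v)) \<in> EP"
  shows "\<exists>a u b. ((a, u), (b, 0)) \<in> EP"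
  using assms
proof (induction "nat (u + v)" arbitrary: a u b v rule: less_induct)
  case less
  note cl = EP_closed[OF less.prems]
  consider "v = 0" | "u = 0" | "0 < v" "v \<le> u" | "0 < u" "u < v"
    using cl by linarith
  then show ?case
  proof cases
    case 1
    then show ?thesis
      using less.prems by blast
  next
    case 2
    then show ?thesis
      using EP_swap[OF less.prems] by blast
  next
    case 3
    have "((a \<circ> inv' b, u - v), (b, v)) \<in> EP"
      using EP_div[OF less.prems] 3 cl by (simp add: mod_pos_pos_trivial)
    then show ?thesis
      using less.hyps[of "u - v" v] 3 by simp
  next
    case 4
    have "((b \<circ> inv' a, v - u), (a, u)) \<in> EP"
      using EP_div[OF EP_swap[OF less.prems]] 4 cl by (simp add: mod_pos_pos_trivial)
    then show ?thesis
      using less.hyps[of "v - u" u] 4 by simp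
  qed
qed

text \<open>The witness is \<open>a\<close> followed by \<open>k\<close> factors \<open>b\<close>;
  of its A_4-component only the class modulo V is retained.\<close>

lemma EP_slide:
  assumes "((a, u), (b, v)) \<in> EP"
  shows "\<exists>a'. ((a', (u + int k * v) mod int m), (b, v)) \<in> EP \<and> chi a' = (chi a + int k * chi b) mod 3"
proof (induction k)
  case 0
  have "chi a mod 3 = chi a"
    using chi_range[OF EP_closed(1)[OF assms]] by auto
  then show ?case
    using assms EP_closed[OF assms] by (auto simp: mod_pos_pos_trivial)
next
  case (Suc k)
  then obtain a' where a': "((a', (u + int k * v) mod int m), (b, v)) \<in> EP"
    "chi a' = (chi a + int k * chi b) mod 3"
    by blast
  have "((u + int k * v) mod int m + v) mod int m = (u + int (Suc k) * v) mod int m"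
    by (subst mod_add_left_eq) (simp add: algebra_simps)
  moreover have "chi (a' \<circ> b) = (chi a + int k * chi b + chi b) mod 3"
    using a'(2) EP_closed[OF a'(1)] by (simp add: chi_comp mod_add_left_eq)
  then have "chi (a' \<circ> b) = (chi a + int (Suc k) * chi b) mod 3"
    by (simp add: algebra_simps)
  ultimately show ?case
    using EP_mult[OF a'(1)] by metis
qed

text \<open>All Z/m-components are multiples of \<open>u\<close> modulo m, so a common divisor of
  \<open>u\<close> and m divides each of them, in particular the residue of 1. Writing
  \<open>1 mod int m\<close> covers m = 1 as well.\<close>

lemma EP_coprime:
  assumes "((a, u), (b, 0)) \<in> EP"
  shows "coprime u (int m)"
proof -
  have "gcd u (int m) dvd 1 mod int m"
    by (rule EP_all[OF assms, where P = "\<lambda>a k. gcd u (int m) dvd k" and g = b0])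
      (use m in \<open>simp_all add: dvd_mod b0_A4\<close>)
  then show ?thesis
    by (simp add: dvd_mod_iff coprime_iff_gcd_eq_1)
qed

lemma EP_chi_nonzero: "\<exists>a u b. ((a, u), (b, 0)) \<in> EP \<and> chi b \<noteq> 0"
proof -
  obtain a u b where ab: "((a, u), (b, 0)) \<in> EP"
    using EP_euclid epi_pairs_self[OF group_A4Z f] by (metis prod.collapse)
  note cl = EP_closed[OF ab]
  have id: "chi id = 0"
    by (simp add: chi_def chi4_def)
  show ?thesis
  proof (cases "chi b = 0")
    case True
    have "chi a \<noteq> 0"
    proof
      assume "chi a = 0"
      then have "chi b0 = 0"
        using EP_all[OF ab, where P = "\<lambda>g k. chi g = 0" and g = b0 and k = 0] True m b0_A4
        by (simp add: chi_comp chi_inv id)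
      then show False
        by (simp add: chi_b0)
    qed
    moreover have "\<not> 3 dvd int m"
    proof
      assume 3: "3 dvd int m"
      \<comment> \<open>Since 3 divides m, a congruence modulo 3 on the Z/m-component survives
        reduction modulo m.\<close>
      have mm: "(x * (y mod int m)) mod 3 = (x * y) mod 3" for x y
        using mod_mod_cancel[OF 3] by (metis mod_mult_right_eq)
      \<comment> \<open>The condition says that the image of \<open>(g, k)\<close> in Z/3 x Z/3 is
        proportional to that of \<open>(a, u)\<close>. It defines a subgroup and holds at
        \<open>(b, 0)\<close> because \<open>chi b = 0\<close>; at \<open>(b0, 0)\<close> it forces
        3 to divide \<open>u\<close>.\<close>
      have "(u * chi b0) mod 3 = (chi a * 0) mod 3"
      proof (rule EP_all[OF ab, where P = "\<lambda>g k. (u * chi g) mod 3 = (chi a * k) mod 3"])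
        fix g h k l
        assume *: "g \<in> carrier A4" "h \<in> carrier A4"
          "(u * chi g) mod 3 = (chi a * k) mod 3" "(u * chi h) mod 3 = (chi a * l) mod 3"
        have "(u * chi g + u * chi h) mod 3 = (chi a * k + chi a * l) mod 3"
          using *(3,4) by (rule mod_add_cong)
        then show "(u * chi (g \<circ> h)) mod 3 = (chi a * ((k + l) mod int m)) mod 3"
          by (simp add: chi_comp *(1,2) mm mod_mult_right_eq distrib_left)
      next
        fix g k
        assume *: "g \<in> carrier A4" "(u * chi g) mod 3 = (chi a * k) mod 3"
        have "(- (u * chi g)) mod 3 = (- (chi a * k)) mod 3"
          using *(2) by (rule mod_minus_cong)
        then show "(u * chi (inv' g)) mod 3 = (chi a * ((- k) mod int m)) mod 3"
          by (simp add: chi_inv *(1) mm mod_mult_right_eq)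
      qed (use m b0_A4 in \<open>simp_all add: id True mult.commute\<close>)
      then have "3 dvd u"
        by (simp add: chi_b0 dvd_eq_mod_eq_0)
      then show False
        using 3 coprime_common_divisor[OF EP_coprime[OF ab]] by fastforce
    qed
    ultimately have "(int m * chi a) mod 3 \<noteq> 0"
      using chi_range[OF cl(1)] by (auto, presburger+)
    moreover obtain b' where "((b', (0 + int m * u) mod int m), (a, u)) \<in> EP"
      "chi b' = (chi b + int m * chi a) mod 3"
      using EP_slide[OF EP_swap[OF ab], of m] by blast
    ultimately show ?thesis
      using True EP_swap by fastforce
  qed (use ab in blast)
qed

lemma EP_case:
  obtains a u b where "((a, u), (b, 0)) \<in> EP" "chi a = 0" "a \<noteq> id" "chi b \<noteq> 0"
proof -
  obtain a' u' b where ab': "((a', u'), (b, 0)) \<in> EP" and b: "chi b \<noteq> 0"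
    using EP_chi_nonzero by blast
  \<comment> \<open>As \<open>chi b\<close> is 1 or -1 modulo 3, its square is 1, so adding
    \<open>k * chi b\<close> turns \<open>chi a'\<close> into \<open>3 * chi a'\<close>, which
    vanishes modulo 3.\<close>
  define k where "k = nat (2 * chi a' * chi b)"
  have "chi a' \<in> {0, 1, 2}" "chi b \<in> {1, 2}"
    using b chi_range[OF EP_closed(1)[OF ab']] chi_range[OF EP_closed(2)[OF ab']] by simp_all
  then have k: "(chi a' + int k * chi b) mod 3 = 0"
    unfolding k_def by (elim insertE emptyE) simp_all
  obtain a where "((a, (u' + int k * 0) mod int m), (b, 0)) \<in> EP \<and>
      chi a = (chi a' + int k * chi b) mod 3"
    using EP_slide[OF ab', of k] by (rule exE)
  then have ab: "((a, (u' + int k * 0) mod int m), (b, 0)) \<in> EP" and a: "chi a = 0"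
    unfolding k by (rule conjunct1, rule conjunct2)
  \<comment> \<open>If \<open>a\<close> were the identity, both A_4-components would commute with
    \<open>b\<close>, hence all of A_4 would. Then \<open>b\<close> commutes with \<open>a0\<close>,
    and \<open>commute_a0\<close> contradicts \<open>chi b \<noteq> 0\<close>.\<close>
  have "a \<noteq> id"
  proof
    assume "a = id"
    have 1: "b \<circ> (g \<circ> h) = g \<circ> h \<circ> b" if "b \<circ> g = g \<circ> b" "b \<circ> h = h \<circ> b" for g h
    proof -
      have "b \<circ> (g \<circ> h) = (b \<circ> g) \<circ> h"
        by (rule comp_assoc[symmetric])
      also have "\<dots> = g \<circ> (b \<circ> h)"
        unfolding that(1) by (rule comp_assoc)
      also have "\<dots> = g \<circ> h \<circ> b"
        unfolding that(2) by (rule comp_assoc[symmetric])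
      finally show ?thesis .
    qed
    have 2: "b \<circ> inv' g = inv' g \<circ> b" if g: "g \<in> carrier A4" and *: "b \<circ> g = g \<circ> b" for g
    proof -
      have i: "g \<circ> inv' g = id" "inv' g \<circ> g = id"
        using A4_permutes[OF g] permutes_inv_o by blast+
      have "b \<circ> inv' g = (inv' g \<circ> g) \<circ> (b \<circ> inv' g)"
        unfolding i(2) by (rule id_comp[symmetric])
      also have "\<dots> = inv' g \<circ> (g \<circ> b) \<circ> inv' g"
        by (simp only: comp_assoc)
      also have "\<dots> = inv' g \<circ> b \<circ> (g \<circ> inv' g)"
        unfolding *[symmetric] by (simp only: comp_assoc)
      also have "\<dots> = inv' g \<circ> b"
        unfolding i(1) by (rule comp_id)
      finally show ?thesis .
    qed
    have "b \<circ> a0 = a0 \<circ> b"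
    proof (rule EP_all[OF ab, where P = "\<lambda>g k. b \<circ> g = g \<circ> b" and k = 0])
      show "b \<circ> id = id \<circ> b" "b \<circ> a = a \<circ> b"
        unfolding \<open>a = id\<close> by (simp_all only: comp_id id_comp)
      show "(0::int) < int m"
        using m by simp
    qed (rule 1 2 refl a0_A4 order_refl; assumption)+
    then show False
      using commute_a0 EP_closed(2)[OF ab] b by blast
  qed
  then show ?thesis
    using that[OF ab a _ b] by blast
qed

end

section \<open>Automorphisms of A_4 x Z/m and the standard pair\<close>

lemma iso_restrict_auto:
  assumes "group G" "h \<in> iso G G"
  shows "restrict h (carrier G) \<in> auto G"
proof -
  have "h \<in> hom G G"
    using assms(2) by (simp add: iso_def)
  then have "restrict h (carrier G) \<in> hom G G"
    by (rule group.hom_restrict[OF assms(1)]) simp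
  then show ?thesis
    using assms(2) by (simp add: auto_def Bij_def iso_def)
qed

lemma mult_iso_integer_mod_group:
  assumes "m \<ge> 1" "(w * u) mod int m = 1 mod int m"
  shows "(\<lambda>k. (w * k) mod int m) \<in> iso (integer_mod_group m) (integer_mod_group m)"
proof (rule isoI)
  have c: "carrier (integer_mod_group m) = {0..<int m}"
    using assms(1) by (simp add: carrier_integer_mod_group)
  show "(\<lambda>k. (w * k) mod int m) \<in> hom (integer_mod_group m) (integer_mod_group m)"
  proof (rule homI)
    show "(w * k) mod int m \<in> carrier (integer_mod_group m)" for k
      unfolding c using assms(1) by simp
    show "(w * (k \<otimes>\<^bsub>integer_mod_group m\<^esub> l)) mod int m
        = ((w * k) mod int m) \<otimes>\<^bsub>integer_mod_group m\<^esub> ((w * l) mod int m)" for k l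
      by (simp only: mult_integer_mod_group mod_mult_right_eq mod_add_eq distrib_left)
  qed
  have wu: "(w * (u * k mod int m)) mod int m = k" "(u * (w * k mod int m)) mod int m = k"
    if "k \<in> {0..<int m}" for k
  proof -
    have "(w * u * k) mod int m = ((w * u) mod int m * k) mod int m"
      by (rule mod_mult_left_eq[symmetric])
    also have "\<dots> = (1 * k) mod int m"
      unfolding assms(2) by (rule mod_mult_left_eq)
    also have "\<dots> = k"
      using that by simp
    finally have 1: "(w * u * k) mod int m = k" .
    show "(w * (u * k mod int m)) mod int m = k"
      unfolding mod_mult_right_eq using 1 by (simp only: mult.assoc)
    show "(u * (w * k mod int m)) mod int m = k"
      unfolding mod_mult_right_eq using 1 by (simp only: mult.assoc mult.left_commute)
  qed
  show "bij_betw (\<lambda>k. (w * k) mod int m) (carrier (integer_mod_group m)) (carrier (integer_mod_group m))"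
  proof (rule bij_betw_byWitness[where f' = "\<lambda>k. (u * k) mod int m"])
    show "\<forall>k\<in>carrier (integer_mod_group m). (u * ((w * k) mod int m)) mod int m = k"
      "\<forall>k\<in>carrier (integer_mod_group m). (w * ((u * k) mod int m)) mod int m = k"
      unfolding c by (rule ballI, rule wu, assumption)+
    have r: "x mod int m \<in> carrier (integer_mod_group m)" for x
      unfolding c using assms(1) by simp
    show "(\<lambda>k. (w * k) mod int m) ` carrier (integer_mod_group m) \<subseteq> carrier (integer_mod_group m)"
      "(\<lambda>k. (u * k) mod int m) ` carrier (integer_mod_group m) \<subseteq> carrier (integer_mod_group m)"
      by (rule image_subsetI, rule r)+
  qed
qed

lemma EP_standard:
  assumes m: "m \<ge> 1" and f: "f \<in> Epi F2 (A4Z m)"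
  shows "((a0, 1 mod int m), (b0, 0)) \<in> epi_pairs (A4Z m) f"
proof -
  obtain a u b where ab: "((a, u), (b, 0)) \<in> epi_pairs (A4Z m) f"
    "chi a = 0" "a \<noteq> id" "chi b \<noteq> 0"
    using EP_case[OF m f] .
  note cl = epi_pairs_closed[OF group_A4Z f ab(1)]
  then have A: "a \<in> carrier A4" "b \<in> carrier A4"
    by simp_all
  obtain t where t: "t permutes {1..4}" "a \<circ> t = t \<circ> a0" "b \<circ> t = t \<circ> b0"
    using A4_conj[OF A ab(2-4)] .
  \<comment> \<open>Bezout provides the inverse \<open>w\<close> of \<open>u\<close> modulo m;
    multiplication by it sends \<open>u\<close> to 1 and fixes 0.\<close>
  obtain w z where "w * u + z * int m = 1"
    using EP_coprime[OF m f ab(1)] bezout_int[of u "int m"] by auto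
  then have wu: "(w * u) mod int m = 1 mod int m"
    by (metis mod_mult_self1 mult.commute)
  let ?s = "inv' t"
  let ?h = "\<lambda>(g, k). (?s \<circ> g \<circ> inv' ?s, (w * k) mod int m)"
  have "?h \<in> iso (A4Z m) (A4Z m)"
    using group.DirProd_iso_set_trans[OF alt_group_is_group conj_iso_A4[OF permutes_inv[OF t(1)]]
        mult_iso_integer_mod_group[OF m wu]] .
  then have "(restrict ?h (carrier (A4Z m)) (a, u), restrict ?h (carrier (A4Z m)) (b, 0)) \<in> epi_pairs (A4Z m) f"
    by (intro epi_pairs_auto[OF group_A4Z f ab(1)] iso_restrict_auto group_A4Z)
  moreover have "?s \<circ> a \<circ> inv' ?s = a0" "?s \<circ> b \<circ> inv' ?s = b0"
    using t permutes_inv_inv[OF t(1)] permutes_inv_o(2)[OF t(1)]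
    by (metis comp_assoc id_comp)+
  ultimately show ?thesis
    using cl wu by (simp only: restrict_apply' prod.case) simp
qed

section \<open>Existence: the standard pair generates\<close>

lemma Epi_F2_A4Z:
  assumes m: "m \<ge> 1"
  shows "Epi F2 (A4Z m) \<noteq> {}"
proof (rule Epi_F2_exists[OF group_A4Z])
  interpret group "A4Z m"
    by (rule group_A4Z)
  show a: "(a0, 1 mod int m) \<in> carrier (A4Z m)" and b: "(b0, 0) \<in> carrier (A4Z m)"
    using m a0_A4 b0_A4 unfolding carrier_A4Z[OF m] by simp_all
  fix S assume S: "subgroup S (A4Z m)" and aS: "(a0, 1 mod int m) \<in> S" and bS: "(b0, 0) \<in> S"
  have mult: "(g \<circ> h, (k + l) mod int m) \<in> S" if "(g, k) \<in> S" "(h, l) \<in> S" for g h k l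
    using subgroup.m_closed[OF S that] unfolding mult_A4Z .
  have mult0: "(g \<circ> h, 0) \<in> S" if "(g, 0) \<in> S" "(h, 0) \<in> S" for g h
    using mult[OF that] by simp
  have p: "a0 permutes {1..4}" "b0 permutes {1..4}"
    using a0_A4 b0_A4 A4_permutes by blast+
  have "a0 \<circ> a0 = id"
    by (rule four_inj) (simp_all add: p permutes_compose permutes_id four_comp four_a0 comp4_def)
  then have ia: "inv' a0 = a0"
    by (simp add: inv_unique_comp)
  have "(a0, (- (1 mod int m)) mod int m) \<in> S"
    using subgroup.m_inv_closed[OF S aS] unfolding inv_A4Z[OF a] ia .
  \<comment> \<open>This is the commutator of \<open>(b0, 0)\<close> and
    \<open>(a0, 1 mod int m)\<close>, as \<open>b0\<close> has order 3 and \<open>a0\<close> order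
    2. Its Z/m-component vanishes, and its A_4-component is the product of \<open>a0\<close> with a
    conjugate of it. Conjugation by \<open>b0\<close> takes that product to \<open>a0\<close>, which
    separates the two components.\<close>
  then have "(b0 \<circ> a0 \<circ> (b0 \<circ> b0) \<circ> a0, (1 mod int m + (- (1 mod int m)) mod int m) mod int m) \<in> S"
    using mult[OF mult[OF mult[OF bS aS] mult0[OF bS bS]]] by (simp add: mod_add_left_eq)
  then have "(b0 \<circ> a0 \<circ> (b0 \<circ> b0) \<circ> a0, 0) \<in> S"
    by (simp add: mod_add_right_eq)
  then have "(b0 \<circ> (b0 \<circ> a0 \<circ> (b0 \<circ> b0) \<circ> a0) \<circ> (b0 \<circ> b0), 0) \<in> S"
    using mult0 bS by blast
  moreover have "b0 \<circ> (b0 \<circ> a0 \<circ> (b0 \<circ> b0) \<circ> a0) \<circ> (b0 \<circ> b0) = a0"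
    by (rule four_inj)
      (simp_all add: p permutes_compose four_comp four_a0 four_b0 comp4_def)
  ultimately have a0S: "(a0, 0) \<in> S"
    by simp
  have "(id, 0) \<in> S"
    using subgroup.one_closed[OF S] by (simp add: alt_group_one)
  then have gS: "(g, 0) \<in> S" if "g \<in> carrier A4" for g
    by (rule A4_generated[of "\<lambda>g. (g, 0) \<in> S", OF a0S bS _ mult0 that])
  have 1: "(id, 1 mod int m) \<in> S"
    using mult[OF aS a0S] \<open>a0 \<circ> a0 = id\<close> by simp
  have kS: "(id, int n mod int m) \<in> S" for n
  proof (induction n)
    case 0
    then show ?case
      using \<open>(id, 0) \<in> S\<close> by (simp only: of_nat_0 mod_0)
  next
    case (Suc n)
    then show ?case
      using mult[OF 1 Suc] by (simp add: mod_add_eq)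
  qed
  show "carrier (A4Z m) \<subseteq> S"
  proof
    fix x assume "x \<in> carrier (A4Z m)"
    then obtain g k where x: "x = (g, k)" "g \<in> carrier A4" "0 \<le> k" "k < int m"
      using carrier_A4Z[OF m] by (metis prod.collapse)
    then have "(g \<circ> id, (0 + int (nat k) mod int m) mod int m) \<in> S"
      using mult[OF gS[OF x(2)] kS] by blast
    then show "x \<in> S"
      using x by (simp add: mod_pos_pos_trivial)
  qed
qed

theorem proposition8p3:
  fixes m :: nat and G :: "((nat \<Rightarrow> nat) \<times> int) monoid"
  assumes "m \<ge> 1" and "G = alt_group 4 \<times>\<times> integer_mod_group m"
  shows "card (Epi_classes F2 G) = 1 \<and>
    Epi F2 G \<noteq> {} \<and>
    (\<forall>f\<in>Epi F2 G. \<forall>f'\<in>Epi F2 G. \<exists>\<phi>\<in>auto F2. \<exists>\<psi>\<in>auto G.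
       f' = compose (carrier F2) \<psi> (compose (carrier F2) f \<phi>))"
proof -
  have G: "group G"
    unfolding assms(2) by (rule group_A4Z)
  have ne: "Epi F2 G \<noteq> {}"
    unfolding assms(2) by (rule Epi_F2_A4Z[OF assms(1)])
  have rel: "(f, f') \<in> Epi_rel F2 G" if "f \<in> Epi F2 G" "f' \<in> Epi F2 G" for f f'
    using epi_pairs_Epi_rel[OF G that] EP_standard[OF assms(1)] that unfolding assms(2) by blast
  have "Epi_rel F2 G = Epi F2 G \<times> Epi F2 G"
    using rel by (auto simp: Epi_rel_def)
  then have "Epi_classes F2 G = {Epi F2 G}"
    using ne by (auto simp: Epi_classes_def quotient_def)
  then have "card (Epi_classes F2 G) = 1"
    by simp
  moreover have "\<forall>f\<in>Epi F2 G. \<forall>f'\<in>Epi F2 G. \<exists>\<phi>\<in>auto F2. \<exists>\<psi>\<in>auto G.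
       f' = compose (carrier F2) \<psi> (compose (carrier F2) f \<phi>)"
    using rel by (simp add: Epi_rel_def)
  ultimately show ?thesis
    using ne by blast
qed

end
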